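(* Let $X$ be a Banach space over $\mathbb{K}=\mathbb{R}$ or $\mathbb{C}$, and let $f:X\to X$, $f=I+K+C$, be a weakly coercive operator, where: (i) $I:X\to X$ is the identity operator; (ii) $K:X\to X$ is a linear $k$-contractive operator, with $k\in[0,1)$; (iii) $C:X\to X$ is a $C^{1}$ compact operator; (iv) $I+K+C'(x)$ is a weakly coercive operator for all $x\in X$, where $C'(x)$ is the Fréchet derivative of $C$ at $x$. Then: (a) $f$ is a global $C^{1}$-diffeomorphism (of $X$ onto $X$). (b) If $K_{1}=-K$ and $C_{1}=-C$, then $K_{1}+C_{1}$ has a unique fixed point.
   Context: Operators are not assumed linear unless stated. An operator $A:X\to X$ is weakly coercive if $\|A(u)\|\to\infty$ if and only if $\|u\|\to\infty$. It is compact if it is continuous and maps every bounded set to a relatively compact set. It is $k$-contractive ($0\le k<1$) if $\|A(x)-A(y)\|\le k\|x-y\|$ for all $x,y\in X$. "$C^1$" means continuously Fréchet differentiable. A $C^{1}$-diffeomorphism is a bijection which is $C^1$ and whose inverse is $C^1$. *)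

theory Defs
  imports "HOL-Analysis.Analysis"
begin

text \<open>
  The scalar fields \<open>\<real>\<close> and \<open>\<complex>\<close>, treated uniformly: the real scalars either exhaust the field, or
  together with a square root \<open>\<i>\<close> of \<open>-1\<close> they span it. As the norm of a
  \<^class>\<open>real_normed_field\<close> is multiplicative, it is then the usual absolute value.
\<close>

class real_or_complex = real_normed_field +
  assumes real_or_complex:
    "(\<forall>z. \<exists>a. z = a *\<^sub>R 1) \<or>
     (\<exists>i. i * i = - 1 \<and> (\<forall>z. \<exists>a b. z = a *\<^sub>R 1 + b *\<^sub>R i))"

instance real :: real_or_complex
  by standard simp

instance complex :: real_or_complex
proof
  have "\<i> * \<i> = - 1 \<and> (\<forall>z. \<exists>a b. z = a *\<^sub>R 1 + b *\<^sub>R \<i>)"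
    by (auto simp: complex_eq_iff)
  then show "(\<forall>z::complex. \<exists>a. z = a *\<^sub>R 1) \<or>
     (\<exists>i::complex. i * i = - 1 \<and> (\<forall>z. \<exists>a b. z = a *\<^sub>R 1 + b *\<^sub>R i))"
    by blast
qed

text \<open>
  A Banach space over \<open>'k\<close>. The type class \<^class>\<open>banach\<close> supplies norm, completeness and the
  underlying real vector space structure, which has to be the restriction of \<open>scl\<close> to the reals.
\<close>

locale banach_over = vector_space scl
  for scl :: "'k::real_or_complex \<Rightarrow> 'a::banach \<Rightarrow> 'a" +
  assumes scl_of_real: "scl (of_real r) x = r *\<^sub>R x"
    and norm_scl: "norm (scl c x) = norm c * norm x"

lemma banach_over_scaleR: "banach_over ((*\<^sub>R) :: real \<Rightarrow> 'a::banach \<Rightarrow> 'a)"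
  by unfold_locales (auto simp: algebra_simps)

lemma banach_over_complex: "banach_over ((*) :: complex \<Rightarrow> complex \<Rightarrow> complex)"
  by unfold_locales (auto simp: algebra_simps norm_mult scaleR_conv_of_real)

definition weakly_coercive :: "('a::real_normed_vector \<Rightarrow> 'a) \<Rightarrow> bool" where
  "weakly_coercive A \<longleftrightarrow>
    (\<forall>u :: nat \<Rightarrow> 'a.
      filterlim (\<lambda>n. norm (A (u n))) at_top sequentially \<longleftrightarrow>
      filterlim (\<lambda>n. norm (u n)) at_top sequentially)"

definition compact_operator :: "('a::real_normed_vector \<Rightarrow> 'a) \<Rightarrow> bool" where
  "compact_operator A \<longleftrightarrow>
    continuous_on UNIV A \<and> (\<forall>B. bounded B \<longrightarrow> compact (closure (A ` B)))"

definition contractive :: "real \<Rightarrow> ('a::real_normed_vector \<Rightarrow> 'a) \<Rightarrow> bool" where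
  "contractive k A \<longleftrightarrow> 0 \<le> k \<and> k < 1 \<and> (\<forall>x y. norm (A x - A y) \<le> k * norm (x - y))"

text \<open>
  \<^const>\<open>has_derivative\<close> is Frechet differentiability over \<open>\<real>\<close>; over \<open>'k\<close> the derivative must in
  addition be linear for \<open>scl\<close>. Continuity of \<open>D\<close> is with respect to the operator norm.
\<close>

definition C1_operator ::
    "('k::real_or_complex \<Rightarrow> 'a::banach \<Rightarrow> 'a) \<Rightarrow> ('a \<Rightarrow> 'a) \<Rightarrow> bool" where
  "C1_operator scl A \<longleftrightarrow>
    (\<exists>D :: 'a \<Rightarrow> 'a \<Rightarrow>\<^sub>L 'a.
      (\<forall>x. (A has_derivative blinfun_apply (D x)) (at x) \<and>
           Vector_Spaces.linear scl scl (blinfun_apply (D x))) \<and>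
      continuous_on UNIV D)"

definition C1_diffeomorphism ::
    "('k::real_or_complex \<Rightarrow> 'a::banach \<Rightarrow> 'a) \<Rightarrow> ('a \<Rightarrow> 'a) \<Rightarrow> bool" where
  "C1_diffeomorphism scl A \<longleftrightarrow> bij A \<and> C1_operator scl A \<and> C1_operator scl (inv A)"

end

theory Submission
  imports Defs
begin

text \<open>
  The map \<open>f = I + K + C\<close> is a diffeomorphism because it is a proper local diffeomorphism of a simply
  connected space, which is the Hadamard global inversion argument.

  \<^emph>\<open>Local invertibility.\<close> The derivative of a compact operator is compact
  (\<open>compact_operator_derivative\<close>), so \<open>f'(x)\<close> is a compact perturbation of \<open>I + K\<close>, which is invertible
  as \<open>K\<close> is a contraction. For a linear map, weak coercivity is a lower bound \<open>c \<parallel>v\<parallel> \<le> \<parallel>T v\<parallel>\<close>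
  (\<open>weakly_coercive_linear_bounded_below\<close>), in particular injectivity, and by the Riesz theory of
  compact operators an injective compact perturbation of an invertible operator is onto
  (\<open>contractive_plus_compact_bounded_below_surj\<close>). So each \<open>f'(x)\<close> has a bounded inverse, and a
  contraction argument shows that \<open>f\<close> is locally injective and open
  (\<open>invertible_derivative_locally_injective_open\<close>).

  \<^emph>\<open>Properness.\<close> If \<open>f(x\<^sub>n)\<close> converges, then \<open>x\<^sub>n\<close> is bounded by weak coercivity of \<open>f\<close>; along a
  subsequence \<open>C(x\<^sub>n)\<close> converges, hence so does \<open>x\<^sub>n + K(x\<^sub>n)\<close>, hence so does \<open>x\<^sub>n\<close>
  (\<open>contractive_plus_compact_proper\<close>).

  \<^emph>\<open>Globalisation.\<close> A proper local homeomorphism is a covering map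
  (\<open>proper_local_homeomorphism_covering_space\<close>), and a covering map between normed spaces, being one
  of a simply connected base by a connected space, is injective (\<open>covering_space_normed_space_bij\<close>).
  The inverse is \<open>C\<^sup>1\<close> because inversion of bounded operators is continuous in the operator norm
  (\<open>continuous_on_blinfun_inverse\<close>). Finally, the fixed points of \<open>- K - C\<close> are the zeros of \<open>f\<close>.
\<close>
section \<open>Weak coercivity\<close>

lemma weakly_coercive_imp_norm_bound:
  assumes "weakly_coercive A"
  shows "\<exists>R. \<forall>x. norm (A x) \<le> B \<longrightarrow> norm x \<le> R"
proof (rule ccontr)
  assume "\<not> ?thesis"
  then have "\<forall>n. \<exists>x. norm (A x) \<le> B \<and> norm x > real n"
    by (meson not_le)
  then obtain u where u: "\<And>n. norm (A (u n)) \<le> B" "\<And>n. norm (u n) > real n"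
    by metis
  have "filterlim (\<lambda>n. norm (u n)) at_top sequentially"
    using filterlim_at_top_mono[OF filterlim_real_sequentially] u(2)
    by (simp add: eventually_mono less_imp_le)
  then have "filterlim (\<lambda>n. norm (A (u n))) at_top sequentially"
    using assms unfolding weakly_coercive_def by blast
  then have "eventually (\<lambda>n. norm (A (u n)) > B) sequentially"
    by (simp add: filterlim_at_top_dense)
  then show False
    using u(1) by (auto simp: eventually_sequentially not_le[symmetric])
qed

text \<open>
  By homogeneity, a bound on the preimage of the unit ball is a lower bound for \<open>T\<close> everywhere.
\<close>
lemma weakly_coercive_linear_bounded_below:
  assumes "weakly_coercive T" and "linear T"
  obtains c where "c > 0" "\<And>x. c * norm x \<le> norm (T x)"
proof -
  interpret T: linear T by fact
  obtain R where R: "\<forall>x. norm (T x) \<le> 1 \<longrightarrow> norm x \<le> R"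
    using weakly_coercive_imp_norm_bound[OF assms(1)] ..
  define M where "M = max R 1"
  have M: "M > 0" "\<And>x. norm (T x) \<le> 1 \<Longrightarrow> norm x \<le> M"
    using R by (auto simp: M_def le_max_iff_disj)
  have "norm x \<le> 2 * M * norm (T x)" for x
  proof (cases "norm x = 0")
    case False
    show ?thesis
    proof (rule ccontr)
      assume less: "\<not> ?thesis"
      \<comment> \<open>A vector of norm \<open>2 M\<close>, too long for the preimage of the unit ball.\<close>
      define y where "y = (2 * M / norm x) *\<^sub>R x"
      have "norm (T y) = 2 * M * norm (T x) / norm x"
        using M(1) by (simp add: y_def T.scaleR)
      also have "\<dots> \<le> 1"
        using less False by (simp add: divide_simps)
      finally have "norm y \<le> M" by (rule M(2))
      then show False using M(1) False by (simp add: y_def)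
    qed
  qed simp
  then show thesis
    using that[of "1 / (2 * M)"] M(1) by (simp add: divide_simps mult.commute)
qed

section \<open>Compact perturbations of the identity\<close>

text \<open>
  Near \<open>x\<close>, the difference quotients of \<open>C\<close> with a single small step \<open>t\<close> approximate \<open>L\<close> uniformly on a
  bounded set \<open>B\<close>, and for that fixed \<open>t\<close> they form an affine image of a relatively compact set.
  Hence \<open>L(B)\<close> is totally bounded.
\<close>
lemma compact_operator_derivative:
  fixes C :: "'a::banach \<Rightarrow> 'a"
  assumes C: "compact_operator C" and der: "(C has_derivative L) (at x)"
  shows "compact_operator L"
  unfolding compact_operator_def
proof (intro conjI allI impI)
  interpret L: bounded_linear L
    using der by (rule has_derivative_bounded_linear)
  show "continuous_on UNIV L"
    by (rule L.continuous_on) (rule continuous_on_id)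
  fix B :: "'a set" assume "bounded B"
  then obtain b where b: "b > 0" "\<And>v. v \<in> B \<Longrightarrow> norm v \<le> b"
    by (meson bounded_pos)
  show "compact (closure (L ` B))"
    unfolding compact_eq_totally_bounded
  proof (intro conjI allI impI)
    show "complete (closure (L ` B))" by (simp add: complete_eq_closed)
    fix e :: real assume "e > 0"
    \<comment> \<open>The linearisation error, relative to \<open>t\<close>, will be \<open>e/6\<close>, the covering error \<open>e/2\<close>;
      their sum \<open>2e/3\<close> leaves room to pass from closed to open balls of radius \<open>e\<close>.\<close>
    define \<epsilon> where "\<epsilon> = e / (6 * b)"
    have "\<epsilon> > 0" using \<open>e > 0\<close> b by (simp add: \<epsilon>_def)
    obtain d where d: "d > 0"
      "\<And>y. norm (y - x) < d \<Longrightarrow> norm (C y - C x - L (y - x)) \<le> \<epsilon> * norm (y - x)"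
      using der \<open>\<epsilon> > 0\<close> unfolding has_derivative_at_alt by blast
    define t where "t = d / (2 * b)"
    have t: "t > 0" "t * b = d / 2" using d(1) b(1) by (auto simp: t_def)
    have "bounded ((\<lambda>v. x + t *\<^sub>R v) ` B)"
      using \<open>bounded B\<close> by (intro bounded_translation[of "(\<lambda>v. t *\<^sub>R v) ` B", unfolded image_image] bounded_scaling)
    then have "compact (closure (C ` (\<lambda>v. x + t *\<^sub>R v) ` B))"
      using C unfolding compact_operator_def by blast
    then obtain k where k: "finite k"
        "closure (C ` (\<lambda>v. x + t *\<^sub>R v) ` B) \<subseteq> (\<Union>y\<in>k. ball y (t * e / 2))"
      unfolding compact_eq_totally_bounded
      using \<open>e > 0\<close> t by (metis half_gt_zero mult_pos_pos)
    have "L ` B \<subseteq> (\<Union>z\<in>(\<lambda>y. (1 / t) *\<^sub>R (y - C x)) ` k. cball z (2 * e / 3))"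
    proof clarify
      fix v assume v: "v \<in> B"
      have "C (x + t *\<^sub>R v) \<in> closure (C ` (\<lambda>v. x + t *\<^sub>R v) ` B)"
        using v by (intro subsetD[OF closure_subset]) auto
      then obtain y where y: "y \<in> k" "norm (y - C (x + t *\<^sub>R v)) < t * e / 2"
        using k(2) by (auto simp: dist_norm)
      have nv: "t * norm v \<le> d / 2"
        using b(2)[OF v] t by (metis mult_left_mono less_imp_le)
      then have "norm (t *\<^sub>R v) < d" using d(1) t by simp
      then have "norm (C (x + t *\<^sub>R v) - C x - L (t *\<^sub>R v)) \<le> \<epsilon> * norm (t *\<^sub>R v)"
        using d(2)[of "x + t *\<^sub>R v"] by simp
      also have "\<dots> = t * (\<epsilon> * norm v)" using t by simp
      also have "\<dots> \<le> t * (\<epsilon> * b)"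
        using t \<open>\<epsilon> > 0\<close> b(2)[OF v] by (intro mult_left_mono) auto
      also have "\<epsilon> * b = e / 6" using b(1) by (simp add: \<epsilon>_def)
      finally have "norm (y - C x - L (t *\<^sub>R v)) \<le> t * e / 2 + t * (e / 6)"
        using y(2) norm_triangle_ineq[of "y - C (x + t *\<^sub>R v)" "C (x + t *\<^sub>R v) - C x - L (t *\<^sub>R v)"]
        by (simp add: algebra_simps)
      also have "\<dots> = t * (2 * e / 3)" by (simp add: algebra_simps)
      finally have "norm (y - C x - t *\<^sub>R L v) \<le> t * (2 * e / 3)"
        by (simp add: L.scaleR)
      moreover have "(1 / t) *\<^sub>R (y - C x) - L v = (1 / t) *\<^sub>R (y - C x - t *\<^sub>R L v)"
        using t(1) by (simp add: algebra_simps)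
      ultimately have "norm ((1 / t) *\<^sub>R (y - C x) - L v) \<le> 2 * e / 3"
        using t(1) by (simp add: divide_simps mult.commute)
      then show "L v \<in> (\<Union>z\<in>(\<lambda>y. (1 / t) *\<^sub>R (y - C x)) ` k. cball z (2 * e / 3))"
        using y(1) by (auto simp: dist_norm)
    qed
    moreover have "closed (\<Union>z\<in>(\<lambda>y. (1 / t) *\<^sub>R (y - C x)) ` k. cball z (2 * e / 3))"
      using k(1) by (intro closed_UN) auto
    ultimately have "closure (L ` B) \<subseteq> (\<Union>z\<in>(\<lambda>y. (1 / t) *\<^sub>R (y - C x)) ` k. cball z (2 * e / 3))"
      by (rule closure_minimal)
    also have "\<dots> \<subseteq> (\<Union>z\<in>(\<lambda>y. (1 / t) *\<^sub>R (y - C x)) ` k. ball z e)"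
      using \<open>e > 0\<close> by (intro UN_mono subset_refl) auto
    finally show "\<exists>k. finite k \<and> closure (L ` B) \<subseteq> (\<Union>x\<in>k. ball x e)"
      using k(1) by blast
  qed
qed

lemma compact_operator_compose_bounded_linear:
  assumes L: "compact_operator L" and S: "bounded_linear S"
  shows "compact_operator (\<lambda>x. S (L x))"
  unfolding compact_operator_def
proof (intro conjI allI impI)
  have contS: "continuous_on A S" for A
    using S by (rule linear_continuous_on)
  show "continuous_on UNIV (\<lambda>x. S (L x))"
    using continuous_on_compose2[OF contS[of UNIV], of UNIV L] L by (simp add: compact_operator_def)
  fix B :: "'a set" assume "bounded B"
  then have c: "compact (S ` closure (L ` B))"
    using L contS by (intro compact_continuous_image) (auto simp: compact_operator_def)
  have "(\<lambda>x. S (L x)) ` B \<subseteq> S ` closure (L ` B)"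
    using closure_subset[of "L ` B"] by auto
  then have "closure ((\<lambda>x. S (L x)) ` B) \<subseteq> S ` closure (L ` B)"
    using c by (simp add: closure_minimal compact_imp_closed)
  then show "compact (closure ((\<lambda>x. S (L x)) ` B))"
    using c by (metis closed_closure compact_Int_closed inf.absorb_iff2)
qed

text \<open>
  The Riesz lemma: normalise \<open>x - a\<close>, where \<open>x\<close> lies in \<open>W\<close> outside \<open>S\<close> and \<open>a\<close> in \<open>S\<close> is within twice the
  distance of \<open>x\<close> to \<open>S\<close>.
\<close>
lemma Riesz_almost_orthogonal:
  fixes S W :: "'a::real_normed_vector set"
  assumes S: "subspace S" "closed S" and W: "subspace W" and sub: "S \<subseteq> W" and "S \<noteq> W"
  obtains z where "z \<in> W" "norm z = 1" "\<And>s. s \<in> S \<Longrightarrow> 1/2 \<le> norm (z - s)"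
proof -
  obtain x where x: "x \<in> W" "x \<notin> S" using assms by blast
  have "S \<noteq> {}" using S(1) subspace_0 by auto
  define d where "d = infdist x S"
  have "d > 0"
    unfolding d_def using S(2) \<open>S \<noteq> {}\<close> x(2) by (rule infdist_pos_not_in_closed)
  have "\<exists>a\<in>S. dist x a < 2 * d"
  proof (rule ccontr)
    assume "\<not> ?thesis"
    then have "2 * d \<le> infdist x S"
      using \<open>S \<noteq> {}\<close> by (auto simp: infdist_def not_less intro: cINF_greatest)
    then show False using \<open>d > 0\<close> by (simp add: d_def)
  qed
  then obtain a where a: "a \<in> S" "norm (x - a) < 2 * d" by (auto simp: dist_norm)
  define m where "m = norm (x - a)"
  have "x \<noteq> a" using a(1) x(2) by auto
  then have m: "m > 0" by (simp add: m_def)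
  define z where "z = (1 / m) *\<^sub>R (x - a)"
  show thesis
  proof
    show "z \<in> W"
      using W x(1) a(1) sub by (auto simp: z_def intro!: subspace_mul subspace_diff)
    show "norm z = 1" using m by (simp add: z_def m_def)
    fix s assume "s \<in> S"
    then have "a + m *\<^sub>R s \<in> S" using S(1) a(1) by (simp add: subspace_add subspace_mul)
    then have "d \<le> norm (x - (a + m *\<^sub>R s))"
      unfolding d_def using infdist_le[of _ S x] by (simp add: dist_norm)
    also have "x - (a + m *\<^sub>R s) = m *\<^sub>R (z - s)"
      using m by (simp add: z_def algebra_simps)
    also have "norm \<dots> = m * norm (z - s)" using m by simp
    finally have "m < 2 * (m * norm (z - s))" using a(2) by (simp add: m_def)
    then show "1/2 \<le> norm (z - s)" using m by simp
  qed
qed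

text \<open>
  The surjectivity half of the Fredholm alternative. If \<open>R = I + M\<close> is not onto, injectivity makes the
  ranges of the powers of \<open>R\<close> a strictly decreasing chain, and the lower bound makes them closed. The
  Riesz lemma then yields unit vectors \<open>z\<^sub>n\<close>, one in each range and far from the next. Since \<open>M\<close> and \<open>- I\<close>
  agree up to \<open>R\<close>, which moves each range into the next, the images \<open>M z\<^sub>n\<close> stay \<open>1/2\<close> apart, against
  the compactness of \<open>M\<close>.
\<close>
lemma bounded_below_id_plus_compact_surj:
  fixes M :: "'a::banach \<Rightarrow> 'a"
  assumes M: "bounded_linear M" "compact_operator M"
    and c: "c > 0" "\<And>x. c * norm x \<le> norm (x + M x)"
  shows "surj (\<lambda>x. x + M x)"
proof (rule ccontr)
  assume nsurj: "\<not> ?thesis"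
  define R where "R = (\<lambda>x. x + M x)"
  have R: "bounded_linear R"
    unfolding R_def using M(1) by (intro bounded_linear_add bounded_linear_ident)
  interpret R: bounded_linear R by fact
  have "inj R"
  proof (rule injI)
    fix x y assume "R x = R y"
    then have "R (x - y) = 0" by (simp add: R.diff)
    then have "c * norm (x - y) \<le> 0" using c(2)[of "x - y"] by (simp add: R_def)
    then show "x = y" using c(1) by (simp add: mult_le_0_iff)
  qed
  define W where "W n = range (R ^^ n)" for n
  have W_Suc: "W (Suc n) = R ` W n" for n by (auto simp: W_def image_comp)
  have W: "subspace (W n) \<and> closed (W n)" for n
  proof (induction n)
    case 0
    show ?case by (simp add: W_def)
  next
    case (Suc n)
    have "complete (R ` W n)"
      using c Suc by (intro complete_isometric_image[OF c(1) _ R]) (auto simp: R_def complete_eq_closed)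
    moreover have "subspace (R ` W n)"
      using Suc R.linear_axioms by (intro linear_subspace_image) auto
    ultimately show ?case by (simp add: W_Suc complete_eq_closed)
  qed
  have W_step: "W (Suc n) \<subseteq> W n" for n
    unfolding W_def by (auto simp: funpow_Suc_right simp del: funpow.simps)
  have W_mono: "W n \<subseteq> W m" if "m \<le> n" for m n
    using lift_Suc_antimono_le[of W, OF W_step that] .
  have W_strict: "W (Suc n) \<noteq> W n" for n
  proof
    assume eq: "W (Suc n) = W n"
    obtain y where y: "y \<notin> range R" using nsurj by (auto simp: R_def)
    have "(R ^^ n) y \<in> W (Suc n)" unfolding eq by (simp add: W_def)
    then obtain x where "(R ^^ n) y = (R ^^ n) (R x)"
      by (auto simp: W_def funpow_Suc_right simp del: funpow.simps)
    moreover have "inj (R ^^ n)" using \<open>inj R\<close> by (rule inj_fn)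
    ultimately show False using y by (auto dest: injD)
  qed
  have "\<forall>n. \<exists>z. z \<in> W n \<and> norm z = 1 \<and> (\<forall>s\<in>W (Suc n). 1/2 \<le> norm (z - s))"
    using Riesz_almost_orthogonal[of "W (Suc n)" "W n" for n] W W_step W_strict by metis
  then obtain z where z: "\<And>n. z n \<in> W n" "\<And>n. norm (z n) = 1"
      "\<And>n s. s \<in> W (Suc n) \<Longrightarrow> 1/2 \<le> norm (z n - s)"
    by metis
  have sep: "1/2 \<le> norm (M (z n) - M (z m))" if "n < m" for n m
  proof -
    have "z m \<in> W (Suc n)" using W_mono[of "Suc n" m] that z(1) by auto
    moreover have "R (z n) \<in> W (Suc n)" "R (z m) \<in> W (Suc n)"
      using z(1) W_mono[of "Suc n" "Suc m"] W_mono[of n m] that unfolding W_Suc by auto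
    ultimately have "R (z n) - R (z m) + z m \<in> W (Suc n)"
      using W by (meson subspace_add subspace_diff)
    then have "1/2 \<le> norm (z n - (R (z n) - R (z m) + z m))" by (rule z(3))
    also have "z n - (R (z n) - R (z m) + z m) = - (M (z n) - M (z m))"
      by (simp add: R_def)
    finally show ?thesis by (simp only: norm_minus_cancel)
  qed
  have "bounded (range z)" using z(2) by (auto simp: bounded_iff)
  then have "compact (closure (M ` range z))" using M(2) by (auto simp: compact_operator_def)
  moreover have "\<forall>n. M (z n) \<in> closure (M ` range z)"
    by (intro allI subsetD[OF closure_subset]) auto
  ultimately obtain l r where "strict_mono r" "((\<lambda>n. M (z n)) \<circ> r) \<longlonglongrightarrow> l"
    unfolding compact_def by meson
  then have "Cauchy ((\<lambda>n. M (z n)) \<circ> r)" by (blast intro: LIMSEQ_imp_Cauchy)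
  then obtain N where "\<And>m n. m \<ge> N \<Longrightarrow> n \<ge> N \<Longrightarrow> dist (M (z (r m))) (M (z (r n))) < 1/2"
    unfolding Cauchy_def by (metis comp_apply half_gt_zero zero_less_one)
  from this[of N "Suc N"] sep[of "r N" "r (Suc N)"] \<open>strict_mono r\<close>
  show False by (auto simp: strict_mono_def dist_norm)
qed

section \<open>Contractive perturbations of the identity\<close>

lemma contractive_id_plus_expanding:
  assumes "contractive k K"
  shows "(1 - k) * norm (x - y) \<le> norm ((x + K x) - (y + K y))"
proof -
  have "norm (x - y) \<le> norm ((x + K x) - (y + K y)) + norm (K x - K y)"
    using norm_triangle_ineq4[of "(x + K x) - (y + K y)" "K x - K y"] by simp
  moreover have "norm (K x - K y) \<le> k * norm (x - y)"
    using assms by (simp add: contractive_def)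
  ultimately show ?thesis by (simp add: algebra_simps)
qed

lemma contractive_id_plus_surj:
  fixes K :: "'a::banach \<Rightarrow> 'a"
  assumes "contractive k K"
  shows "surj (\<lambda>x. x + K x)"
proof (rule surjI)
  fix y
  have "\<exists>!x. y - K x = x"
    using assms unfolding contractive_def
    by (intro banach_fix_type[of k]) (auto simp: dist_norm norm_minus_commute)
  then show "(\<lambda>x. x + K x) (THE x. y - K x = x) = y"
    by (metis (mono_tags, lifting) diff_add_cancel theI')
qed

text \<open>
  With \<open>A = I + K\<close> and its bounded inverse \<open>S\<close>, the operator factors as \<open>A (I + S L)\<close>, where \<open>S L\<close> is
  again compact.
\<close>
lemma contractive_plus_compact_bounded_below_surj:
  fixes K L :: "'a::banach \<Rightarrow> 'a"
  assumes K: "linear K" "contractive k K"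
    and L: "bounded_linear L" "compact_operator L"
    and c: "c > 0" "\<And>x. c * norm x \<le> norm (x + K x + L x)"
  shows "surj (\<lambda>x. x + K x + L x)"
proof -
  define A where "A = (\<lambda>x. x + K x)"
  have k: "0 \<le> k" "k < 1" using K(2) by (auto simp: contractive_def)
  have linA: "linear A"
    unfolding A_def using K(1) by (intro linear_compose_add linear_ident)
  have exp: "(1 - k) * norm x \<le> norm (A x)" for x
    using contractive_id_plus_expanding[OF K(2), of x 0] linear_0[OF K(1)] by (simp add: A_def)
  have Kb: "norm (K x) \<le> k * norm x" for x
    using K(2) linear_0[OF K(1)] unfolding contractive_def by (metis diff_zero)
  have "surj A" unfolding A_def using K(2) by (rule contractive_id_plus_surj)
  have "inj A"
    unfolding linear_injective_0[OF linA]
    using exp k by (metis diff_gt_0_iff_gt mult_le_0_iff norm_eq_zero norm_ge_zero norm_zero not_le order_antisym)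
  define S where "S = inv A"
  have AS: "A (S x) = x" and SA: "S (A x) = x" for x
    using \<open>surj A\<close> \<open>inj A\<close> by (auto simp: S_def surj_f_inv_f)
  have S: "bounded_linear S"
  proof (rule bounded_linear_intro)
    show "S (x + y) = S x + S y" for x y
      using SA[of "S x + S y"] by (simp add: linear_add[OF linA] AS)
    show "S (r *\<^sub>R x) = r *\<^sub>R S x" for r x
      using SA[of "r *\<^sub>R S x"] by (simp add: linear_scale[OF linA] AS)
    show "norm (S x) \<le> norm x * (1 / (1 - k))" for x
      using exp[of "S x"] k by (simp add: AS divide_simps mult.commute)
  qed
  interpret S: bounded_linear S by fact
  have T: "x + K x + L x = A (x + S (L x))" for x
    by (simp add: linear_add[OF linA] AS) (simp add: A_def)
  have "surj (\<lambda>x. x + S (L x))"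
  proof (rule bounded_below_id_plus_compact_surj)
    show "bounded_linear (\<lambda>x. S (L x))" using S L(1) by (rule bounded_linear_compose)
    show "compact_operator (\<lambda>x. S (L x))"
      using L(2) S by (rule compact_operator_compose_bounded_linear)
    show "c / (1 + k) > 0" using c(1) k by simp
    fix x
    have "c * norm x \<le> norm (A (x + S (L x)))" using c(2) T by metis
    also have "\<dots> \<le> (1 + k) * norm (x + S (L x))"
      unfolding A_def using Kb[of "x + S (L x)"] norm_triangle_ineq[of "x + S (L x)" "K (x + S (L x))"]
      by (simp add: algebra_simps)
    finally show "c / (1 + k) * norm x \<le> norm (x + S (L x))"
      using k by (simp add: divide_simps mult.commute)
  qed
  then have "surj (A \<circ> (\<lambda>x. x + S (L x)))"
    using \<open>surj A\<close> by (rule comp_surj)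
  then show ?thesis unfolding comp_def T by simp
qed

section \<open>Proper local homeomorphisms\<close>

text \<open>
  Properness is used in its sequential form: a sequence whose images converge has a convergent
  subsequence. In an infinite-dimensional space it is easier to verify and to apply than compactness
  of preimages of compact sets, to which it is equivalent for continuous maps of metric spaces.
\<close>
lemma sequentially_proper_closed_map:
  fixes f :: "'a::metric_space \<Rightarrow> 'b::metric_space"
  assumes cont: "continuous_on UNIV f"
    and proper: "\<And>x l. (\<lambda>n. f (x n)) \<longlonglongrightarrow> l \<Longrightarrow> \<exists>r a. strict_mono r \<and> (\<lambda>n. x (r n)) \<longlonglongrightarrow> a"
    and "closed T"
  shows "closed (f ` T)"
  unfolding closed_sequential_limits
proof clarify
  fix y l assume y: "\<forall>n. y n \<in> f ` T" "y \<longlonglongrightarrow> l"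
  have "\<forall>n. \<exists>a. a \<in> T \<and> y n = f a" using y(1) unfolding image_iff Bex_def .
  then obtain x where x: "\<And>n. x n \<in> T" "\<And>n. y n = f (x n)" by metis
  then have "(\<lambda>n. f (x n)) \<longlonglongrightarrow> l" using y(2) by (simp flip: x(2))
  then obtain r a where r: "strict_mono r" "(\<lambda>n. x (r n)) \<longlonglongrightarrow> a" using proper by blast
  have "a \<in> T" using \<open>closed T\<close> r(2) x(1) by (metis closed_sequentially)
  have "(\<lambda>n. f (x (r n))) \<longlonglongrightarrow> f a"
    using cont r(2) by (auto simp: continuous_on_eq_continuous_at intro: isCont_tendsto_compose)
  moreover have "(\<lambda>n. f (x (r n))) \<longlonglongrightarrow> l"
    using LIMSEQ_subseq_LIMSEQ[OF y(2) r(1)] by (simp add: comp_def flip: x(2))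
  ultimately have "f a = l" by (rule LIMSEQ_unique)
  then show "l \<in> f ` T" using \<open>a \<in> T\<close> by blast
qed

lemma finite_metric_separation:
  fixes F :: "'a::metric_space set"
  assumes "finite F"
  obtains r where "r > 0" "\<And>x y. x \<in> F \<Longrightarrow> y \<in> F \<Longrightarrow> x \<noteq> y \<Longrightarrow> r \<le> dist x y"
proof -
  define D where "D = insert 1 ((\<lambda>(x, y). dist x y) ` (F \<times> F - Id))"
  have D: "finite D" "D \<noteq> {}" using assms by (auto simp: D_def)
  show thesis
  proof
    show "Min D > 0" using D by (auto simp: D_def)
    show "Min D \<le> dist x y" if "x \<in> F" "y \<in> F" "x \<noteq> y" for x y
      using D that by (intro Min_le) (auto simp: D_def)
  qed
qed

text \<open>
  Fibres are compact and discrete, hence finite, so the points of a fibre have disjoint open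
  neighbourhoods \<open>N x\<close> on which \<open>f\<close> is injective. As \<open>f\<close> is a closed map, the image of the complement
  of their union is closed and misses \<open>y\<close>: near \<open>y\<close> there are no preimages other than those in the
  sheets \<open>N x\<close>. Surjectivity holds because the range is open and closed.
\<close>
lemma proper_local_homeomorphism_covering_space:
  fixes f :: "'a::metric_space \<Rightarrow> 'b::metric_space"
  assumes cont: "continuous_on UNIV f"
    and proper: "\<And>x l. (\<lambda>n. f (x n)) \<longlonglongrightarrow> l \<Longrightarrow> \<exists>r a. strict_mono r \<and> (\<lambda>n. x (r n)) \<longlonglongrightarrow> a"
    and open_map: "\<And>S. open S \<Longrightarrow> open (f ` S)"
    and inj: "\<And>x. \<exists>U. open U \<and> x \<in> U \<and> inj_on f U"
    and conn: "connected (UNIV :: 'b set)"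
  shows "covering_space UNIV f UNIV"
proof
  show "continuous_on UNIV f" by fact
  note closed_map = sequentially_proper_closed_map[OF cont proper]
  have "open (range f)" "closed (range f)"
    using open_map closed_map by auto
  then show "range f = UNIV"
    using conn by (auto simp: connected_clopen)
  fix y :: 'b
  define F where "F = f -` {y}"
  have "compact F"
    unfolding compact_def
  proof (intro allI impI)
    fix x :: "nat \<Rightarrow> 'a" assume x: "\<forall>n. x n \<in> F"
    then have "(\<lambda>n. f (x n)) \<longlonglongrightarrow> y" by (simp add: F_def)
    then obtain r a where r: "strict_mono r" "(\<lambda>n. x (r n)) \<longlonglongrightarrow> a" using proper by blast
    have "closed F"
      unfolding F_def using cont by (simp add: closed_vimage continuous_on_eq_continuous_at)
    then have "a \<in> F" using r(2) x by (metis closed_sequentially)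
    then show "\<exists>l\<in>F. \<exists>r. strict_mono r \<and> (x \<circ> r) \<longlonglongrightarrow> l"
      using r by (auto simp: comp_def)
  qed
  obtain U where U: "\<And>x. open (U x)" "\<And>x. x \<in> U x" "\<And>x. inj_on f (U x)"
    using inj by metis
  obtain F' where F': "F' \<subseteq> F" "finite F'" "F \<subseteq> (\<Union>x\<in>F'. U x)"
    using compactE_image[OF \<open>compact F\<close>, of F U] U(1,2) by blast
  have "F \<subseteq> F'"
  proof
    fix x assume "x \<in> F"
    then obtain z where "z \<in> F'" "x \<in> U z" using F'(3) by blast
    moreover have "f x = f z" using \<open>x \<in> F\<close> \<open>z \<in> F'\<close> F'(1) by (auto simp: F_def)
    ultimately show "x \<in> F'" using U(2,3)[of z] by (metis inj_onD)
  qed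
  then have "finite F" using F'(2) finite_subset by blast
  then obtain r where r: "r > 0" "\<And>x z. x \<in> F \<Longrightarrow> z \<in> F \<Longrightarrow> x \<noteq> z \<Longrightarrow> r \<le> dist x z"
    using finite_metric_separation by blast
  define N where "N x = U x \<inter> ball x (r / 2)" for x
  have N: "open (N x)" "x \<in> N x" "inj_on f (N x)" for x
    using U r(1) by (auto simp: N_def intro: inj_on_subset)
  have N_disj: "N x \<inter> N z = {}" if "x \<in> F" "z \<in> F" "x \<noteq> z" for x z
  proof -
    have "False" if "w \<in> N x" "w \<in> N z" for w
      using that r(2)[OF \<open>x \<in> F\<close> \<open>z \<in> F\<close> \<open>x \<noteq> z\<close>] dist_triangle2[of x z w]
      by (auto simp: N_def dist_commute)
    then show ?thesis by blast
  qed
  define V where "V = (\<Inter>x\<in>F. f ` N x) - f ` (- (\<Union>x\<in>F. N x))"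
  have "closed (f ` (- (\<Union>x\<in>F. N x)))"
    by (rule closed_map) (use N(1) in \<open>auto simp: closed_Compl\<close>)
  moreover have "open (\<Inter>x\<in>F. f ` N x)"
    using \<open>finite F\<close> N(1) open_map by (intro open_INT) auto
  ultimately have "open V" unfolding V_def by (rule open_Diff[rotated])
  have "y \<in> V"
    unfolding V_def using N(2) by (force simp: F_def)
  define v where "v = (\<lambda>x. N x \<inter> f -` V) ` F"
  have "open (f -` V)"
    using \<open>open V\<close> cont by (simp add: open_vimage)
  show "\<exists>T. y \<in> T \<and> openin (top_of_set UNIV) T \<and>
      (\<exists>v. \<Union> v = UNIV \<inter> f -` T \<and> (\<forall>u\<in>v. openin (top_of_set UNIV) u) \<and>
        pairwise disjnt v \<and> (\<forall>u\<in>v. \<exists>q. homeomorphism u T f q))"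
  proof (intro exI[of _ V] exI[of _ v] conjI ballI)
    show "y \<in> V" by fact
    show "openin (top_of_set UNIV) V" using \<open>open V\<close> by simp
    show "\<Union> v = UNIV \<inter> f -` V" by (auto simp: v_def V_def)
    show "pairwise disjnt v"
      using N_disj by (fastforce simp: v_def pairwise_def disjnt_def)
    fix u assume "u \<in> v"
    then obtain x where x: "x \<in> F" "u = N x \<inter> f -` V" by (auto simp: v_def)
    then have "open u" using N(1) \<open>open (f -` V)\<close> by auto
    then show "openin (top_of_set UNIV) u" by simp
    have "V \<subseteq> f ` N x" using x(1) by (auto simp: V_def)
    then have fu: "f ` u = V" using x(2) by auto
    show "\<exists>q. homeomorphism u V f q"
    proof (rule homeomorphism_injective_open_map[OF _ fu, of thesis for thesis])
      show "continuous_on u f" using cont by (rule continuous_on_subset) simp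
      show "inj_on f u" using N(3)[of x] x(2) by (auto intro: inj_on_subset)
      show "openin (top_of_set V) (f ` W)" if "openin (top_of_set u) W" for W
      proof -
        have "open W" using that \<open>open u\<close> openin_open_trans open_openin by (metis openin_open_eq)
        then show ?thesis
          using open_map image_mono[OF openin_imp_subset[OF that], of f] unfolding fu
          by (intro open_subset) auto
      qed
    qed blast
  qed
qed

text \<open>
  As the target is simply connected, the identity lifts through \<open>f\<close> to a section \<open>g\<close> with
  \<open>g (f a) = a\<close>. Then \<open>g \<circ> f\<close> and the identity both lift \<open>f\<close> through itself and agree at \<open>a\<close>, so by
  uniqueness of lifts they agree everywhere.
\<close>
lemma covering_space_normed_space_bij:
  fixes f :: "'a::real_normed_vector \<Rightarrow> 'b::real_normed_vector"
  assumes cov: "covering_space UNIV f UNIV"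
  shows "bij f"
proof (rule bijI)
  show "surj f" using covering_space_imp_surjective[OF cov] .
  have cont: "continuous_on UNIV f" using covering_space_imp_continuous[OF cov] .
  show "inj f"
  proof (rule injI)
    fix a b assume eq: "f a = f b"
    obtain g where g: "continuous_on UNIV g" "g (f a) = a" "\<And>y. f (g y) = y"
      using covering_space_lift_strong[OF cov, of a "f a" UNIV "\<lambda>y. y"]
      by (auto simp: convex_imp_simply_connected locally_path_connected_UNIV)
    have "(\<lambda>x. g (f x)) b = (\<lambda>x. x) b"
    proof (rule covering_space_lift_unique[OF cov, of "\<lambda>x. g (f x)" a "\<lambda>x. x" UNIV f b])
      show "continuous_on UNIV (\<lambda>x. g (f x))"
        using continuous_on_compose2[OF g(1) cont] by simp
    qed (use g cont in auto)
    then show "a = b" using g(2) eq by simp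
  qed
qed

section \<open>Maps with invertible continuous derivatives\<close>

text \<open>
  The core of the inverse function theorem in a Banach space. The Newton-type map
  \<open>h x = x - E (f x)\<close> has vanishing derivative at \<open>x0\<close>, so it is \<open>1/2\<close>-Lipschitz near \<open>x0\<close>. Points with
  equal images are moved by \<open>h\<close> by equal amounts, so they coincide, and a solution of \<open>f x = y\<close> is a
  fixed point of the contraction \<open>h + E y\<close>.
\<close>
lemma invertible_derivative_locally_injective_open:
  fixes f :: "'a::banach \<Rightarrow> 'a" and D :: "'a \<Rightarrow> 'a \<Rightarrow>\<^sub>L 'a"
  assumes der: "\<And>x. (f has_derivative blinfun_apply (D x)) (at x)"
    and contD: "isCont D x0"
    and E: "E o\<^sub>L D x0 = id_blinfun" "inj (blinfun_apply E)"
  obtains r where "r > 0" "inj_on f (ball x0 r)"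
    "\<And>s. 0 < s \<Longrightarrow> s < r \<Longrightarrow> \<exists>e>0. ball (f x0) e \<subseteq> f ` cball x0 s"
proof -
  \<comment> \<open>Chosen so that \<open>norm E * \<eta> \<le> 1/2\<close>; adding \<open>1\<close> covers the zero-dimensional space, where \<open>E = 0\<close>.\<close>
  define \<eta> where "\<eta> = 1 / (2 * (norm E + 1))"
  have "norm E + 1 > 0" by (rule add_nonneg_pos) auto
  then have \<eta>: "\<eta> > 0" by (simp add: \<eta>_def)
  obtain r where r: "r > 0" "\<And>x. dist x x0 < r \<Longrightarrow> dist (D x) (D x0) < \<eta>"
    using contD \<eta> unfolding continuous_at_eps_delta by (auto simp: dist_norm)
  define h where "h x = x - blinfun_apply E (f x)" for x
  have h_der: "(h has_derivative blinfun_apply (E o\<^sub>L (D x0 - D x))) (at x)" for x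
  proof -
    have "(h has_derivative (\<lambda>v. v - blinfun_apply E (blinfun_apply (D x) v))) (at x)"
      unfolding h_def
      by (intro has_derivative_diff has_derivative_ident
          bounded_linear.has_derivative[OF blinfun.bounded_linear_right] der)
    moreover have "blinfun_apply E (blinfun_apply (D x0) v) = v" for v
      using E(1) by (metis blinfun_apply_blinfun_compose blinfun_apply_id_blinfun)
    ultimately show ?thesis
      by (simp add: blinfun.diff_left blinfun.diff_right blinfun_compose.rep_eq comp_def)
  qed
  have h_lip: "norm (h x - h y) \<le> 1/2 * norm (x - y)" if "x \<in> ball x0 r" "y \<in> ball x0 r" for x y
  proof (rule differentiable_bound[OF convex_ball _ _ that])
    fix x assume "x \<in> ball x0 r"
    then have "norm (D x0 - D x) \<le> \<eta>"
      using r(2)[of x] by (simp add: dist_norm dist_commute norm_minus_commute)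
    then have "norm E * norm (D x0 - D x) \<le> norm E * \<eta>" by (simp add: mult_left_mono)
    also have "\<dots> \<le> 1/2" using \<open>norm E + 1 > 0\<close> by (simp add: \<eta>_def divide_simps)
    finally have "norm (E o\<^sub>L (D x0 - D x)) \<le> 1/2"
      using norm_blinfun_compose[of E "D x0 - D x"] by linarith
    then show "onorm (blinfun_apply (E o\<^sub>L (D x0 - D x))) \<le> 1/2"
      by (simp add: norm_blinfun.rep_eq)
    show "(h has_derivative blinfun_apply (E o\<^sub>L (D x0 - D x))) (at x within ball x0 r)"
      using h_der by (rule has_derivative_at_withinI)
  qed
  show thesis
  proof
    show "r > 0" by fact
    show "inj_on f (ball x0 r)"
    proof (rule inj_onI)
      fix x y assume xy: "x \<in> ball x0 r" "y \<in> ball x0 r" "f x = f y"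
      then have "h x - h y = x - y" by (simp add: h_def)
      then show "x = y" using h_lip[OF xy(1,2)] by simp
    qed
    fix s assume s: "0 < s" "s < r"
    define e where "e = s / (2 * (norm E + 1))"
    have "e > 0" using s \<open>norm E + 1 > 0\<close> by (simp add: e_def)
    moreover have "ball (f x0) e \<subseteq> f ` cball x0 s"
    proof
      fix y assume y: "y \<in> ball (f x0) e"
      define \<phi> where "\<phi> x = h x + blinfun_apply E y" for x
      have sub: "x \<in> ball x0 r" if "x \<in> cball x0 s" for x using that s by auto
      have "norm (blinfun_apply E (y - f x0)) \<le> norm E * norm (y - f x0)"
        by (rule norm_blinfun)
      also have "\<dots> \<le> norm E * e"
        using y by (intro mult_left_mono) (auto simp: dist_norm norm_minus_commute)
      also have "\<dots> \<le> s / 2"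
        using s \<open>norm E + 1 > 0\<close> by (simp add: e_def divide_simps mult_left_mono)
      finally have Ey: "norm (blinfun_apply E (y - f x0)) \<le> s / 2" .
      have "\<exists>!x\<in>cball x0 s. \<phi> x = x"
      proof (rule Banach_fix[of _ "1/2"])
        show "complete (cball x0 s)" by (simp add: complete_eq_closed)
        show "cball x0 s \<noteq> {}" using s by simp
        show "\<phi> ` cball x0 s \<subseteq> cball x0 s"
        proof clarify
          fix x assume x: "x \<in> cball x0 s"
          have "\<phi> x - x0 = (h x - h x0) + blinfun_apply E (y - f x0)"
            by (simp add: \<phi>_def h_def blinfun.diff_right)
          then have "norm (\<phi> x - x0) \<le> norm (h x - h x0) + norm (blinfun_apply E (y - f x0))"
            by (metis norm_triangle_ineq)
          also have "norm (h x - h x0) \<le> 1/2 * norm (x - x0)"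
            using sub x s by (intro h_lip) auto
          also have "norm (x - x0) \<le> s" using x by (simp add: dist_norm norm_minus_commute)
          finally show "\<phi> x \<in> cball x0 s"
            using Ey by (simp add: dist_norm norm_minus_commute)
        qed
        show "dist (\<phi> x) (\<phi> z) \<le> 1/2 * dist x z" if "x \<in> cball x0 s" "z \<in> cball x0 s" for x z
          using h_lip[OF sub sub, OF that] by (simp add: \<phi>_def dist_norm)
      qed auto
      then obtain x where x: "x \<in> cball x0 s" "\<phi> x = x" by blast
      then have "blinfun_apply E (f x) = blinfun_apply E y" by (simp add: \<phi>_def h_def)
      then have "f x = y" using E(2) by (simp add: injD)
      then show "y \<in> f ` cball x0 s" using x(1) by blast
    qed
    ultimately show "\<exists>e>0. ball (f x0) e \<subseteq> f ` cball x0 s" by blast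
  qed
qed

text \<open>
  The Hadamard global inversion theorem, with the topological part of its conclusion: \<open>f\<close> is a
  homeomorphism.
\<close>
lemma proper_invertible_derivative_bij:
  fixes f :: "'a::banach \<Rightarrow> 'a" and D E :: "'a \<Rightarrow> 'a \<Rightarrow>\<^sub>L 'a"
  assumes der: "\<And>x. (f has_derivative blinfun_apply (D x)) (at x)"
    and contD: "continuous_on UNIV D"
    and E: "\<And>x. E x o\<^sub>L D x = id_blinfun" "\<And>x. D x o\<^sub>L E x = id_blinfun"
    and proper: "\<And>x l. (\<lambda>n. f (x n)) \<longlonglongrightarrow> l \<Longrightarrow> \<exists>r a. strict_mono r \<and> (\<lambda>n. x (r n)) \<longlonglongrightarrow> a"
  shows "bij f" "continuous_on UNIV (inv f)"
proof -
  have cont: "continuous_on UNIV f"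
    using der by (meson continuous_at_imp_continuous_on has_derivative_continuous)
  have "inj (blinfun_apply (E x))" for x
    using E(2)[of x] by (metis blinfun_apply_blinfun_compose blinfun_apply_id_blinfun injI)
  then have loc: "\<exists>r>0. inj_on f (ball x r) \<and>
      (\<forall>s. 0 < s \<and> s < r \<longrightarrow> (\<exists>e>0. ball (f x) e \<subseteq> f ` cball x s))" for x
    using invertible_derivative_locally_injective_open[OF der _ E(1), of x] contD
    by (metis UNIV_I continuous_on_eq_continuous_at open_UNIV)
  have open_map: "open (f ` S)" if "open S" for S
    unfolding open_contains_ball
  proof clarify
    fix x assume "x \<in> S"
    with that obtain t where t: "t > 0" "cball x t \<subseteq> S" unfolding open_contains_cball by blast
    obtain r where r: "r > 0" "\<forall>s. 0 < s \<and> s < r \<longrightarrow> (\<exists>e>0. ball (f x) e \<subseteq> f ` cball x s)"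
      using loc[of x] by (elim exE conjE) (rule that)
    have "0 < min t (r / 2)" "min t (r / 2) < r"
      using t(1) r(1) by auto
    then obtain e where "e > 0" "ball (f x) e \<subseteq> f ` cball x (min t (r / 2))"
      using r(2) by blast
    then show "\<exists>e>0. ball (f x) e \<subseteq> f ` S"
      using t(2) by (intro exI[of _ e]) fastforce
  qed
  have "covering_space UNIV f UNIV"
  proof (rule proper_local_homeomorphism_covering_space[OF cont proper open_map])
    show "\<exists>U. open U \<and> x \<in> U \<and> inj_on f U" for x
      using loc[of x] by (metis centre_in_ball open_ball)
  qed auto
  then show "bij f" by (rule covering_space_normed_space_bij)
  then have "inv f -` S = f ` S" for S
    by (simp add: bij_vimage_eq_inv_image bij_imp_bij_inv inv_inv_eq)
  then show "continuous_on UNIV (inv f)"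
    using open_map by (simp add: continuous_on_open_vimage)
qed

text \<open>
  From \<open>E x - E a = - E x (D x - D a) E a\<close>: once \<open>D x\<close> is close to \<open>D a\<close>, this identity first bounds
  \<open>E x\<close> by \<open>2 \<parallel>E a\<parallel>\<close> and then makes the difference small.
\<close>
lemma continuous_on_blinfun_inverse:
  fixes D E :: "'b::topological_space \<Rightarrow> 'a::real_normed_vector \<Rightarrow>\<^sub>L 'a"
  assumes contD: "continuous_on UNIV D"
    and E: "\<And>x. E x o\<^sub>L D x = id_blinfun" "\<And>x. D x o\<^sub>L E x = id_blinfun"
  shows "continuous_on UNIV E"
proof -
  have ED: "blinfun_apply (E x) (blinfun_apply (D x) v) = v" and
    DE: "blinfun_apply (D x) (blinfun_apply (E x) v) = v" for x v
    using E by (metis blinfun_apply_blinfun_compose blinfun_apply_id_blinfun)+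
  have "(E \<longlongrightarrow> E a) (at a)" for a
  proof -
    have D: "((\<lambda>x. norm (D x - D a)) \<longlongrightarrow> 0) (at a)"
      using contD by (simp add: continuous_on_def tendsto_norm_zero LIM_zero)
    have bound: "norm (E x - E a) \<le> 2 * norm (E a) * norm (E a) * norm (D x - D a)"
      if small: "norm (E a) * norm (D x - D a) \<le> 1/2" for x
    proof -
      have "E x - E a = - (E x o\<^sub>L (D x - D a) o\<^sub>L E a)"
        by (intro blinfun_eqI) (simp add: blinfun.bilinear_simps ED DE)
      moreover have "norm (E x o\<^sub>L (D x - D a) o\<^sub>L E a) \<le> norm (E x) * (norm (D x - D a) * norm (E a))"
        by (metis (no_types, opaque_lifting) mult.assoc mult_right_mono norm_blinfun_compose norm_ge_zero order_trans)
      ultimately have *: "norm (E x - E a) \<le> norm (E x) * (norm (E a) * norm (D x - D a))"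
        by (simp only: norm_minus_cancel mult.commute[of "norm (E a)"])
      also have "\<dots> \<le> norm (E x) * (1/2)" using small by (intro mult_left_mono) auto
      finally have "norm (E x - E a) \<le> norm (E x) / 2" by simp
      moreover have "norm (E x) \<le> norm (E a) + norm (E x - E a)"
        by (metis add.commute norm_triangle_sub)
      ultimately have "norm (E x) \<le> 2 * norm (E a)" by simp
      then have "norm (E x) * (norm (E a) * norm (D x - D a)) \<le> 2 * norm (E a) * (norm (E a) * norm (D x - D a))"
        by (intro mult_right_mono) auto
      with * show ?thesis by (simp add: mult.assoc)
    qed
    have "((\<lambda>x. norm (E a) * norm (D x - D a)) \<longlongrightarrow> 0) (at a)"
      using tendsto_mult_right_zero[OF D] by simp
    then have "eventually (\<lambda>x. norm (E a) * norm (D x - D a) < 1/2) (at a)"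
      by (rule order_tendstoD) simp
    then have ev: "eventually (\<lambda>x. norm (E x - E a) \<le> 2 * norm (E a) * norm (E a) * norm (D x - D a)) (at a)"
      by eventually_elim (use bound in auto)
    have "((\<lambda>x. norm (E x - E a)) \<longlongrightarrow> 0) (at a)"
      by (rule tendsto_sandwich[OF _ ev tendsto_const tendsto_mult_right_zero[OF D]]) simp
    then show ?thesis by (simp add: LIM_zero_cancel tendsto_norm_zero_iff)
  qed
  then show ?thesis by (simp add: continuous_on_def)
qed

section \<open>The global diffeomorphism theorem\<close>

text \<open>
  Weak coercivity bounds the sequence, so its image under \<open>C\<close> has a convergent subsequence. Then the
  lower bound \<open>(1 - k) \<parallel>x - y\<parallel>\<close> for \<open>I + K\<close> turns convergence of \<open>x\<^sub>n + K(x\<^sub>n)\<close> into the Cauchy property of \<open>x\<^sub>n\<close>.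
\<close>
lemma contractive_plus_compact_proper:
  fixes K C :: "'a::banach \<Rightarrow> 'a"
  assumes K: "contractive k K" and C: "compact_operator C"
    and coer: "weakly_coercive (\<lambda>x. x + K x + C x)"
    and lim: "(\<lambda>n. x n + K (x n) + C (x n)) \<longlonglongrightarrow> l"
  shows "\<exists>r a. strict_mono r \<and> (\<lambda>n. x (r n)) \<longlonglongrightarrow> a"
proof -
  have k: "k < 1" using K by (simp add: contractive_def)
  obtain B where "\<And>n. norm (x n + K (x n) + C (x n)) \<le> B"
    using convergent_imp_Bseq[OF convergentI[OF lim]] unfolding Bseq_def by blast
  moreover obtain R where "\<forall>x. norm (x + K x + C x) \<le> B \<longrightarrow> norm x \<le> R"
    using weakly_coercive_imp_norm_bound[OF coer] ..
  ultimately have "bounded (range x)" by (auto simp: bounded_iff)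
  then have "compact (closure (C ` range x))" using C by (auto simp: compact_operator_def)
  moreover have "\<forall>n. C (x n) \<in> closure (C ` range x)"
    by (intro allI subsetD[OF closure_subset]) auto
  ultimately obtain b r where r: "strict_mono r" "((\<lambda>n. C (x n)) \<circ> r) \<longlonglongrightarrow> b"
    unfolding compact_def by meson
  have "(\<lambda>n. (x (r n) + K (x (r n)) + C (x (r n))) - C (x (r n))) \<longlonglongrightarrow> l - b"
    using LIMSEQ_subseq_LIMSEQ[OF lim r(1)] r(2) by (intro tendsto_diff) (auto simp: comp_def)
  then have cau: "Cauchy (\<lambda>n. x (r n) + K (x (r n)))"
    by (simp add: LIMSEQ_imp_Cauchy)
  have "Cauchy (\<lambda>n. x (r n))"
  proof (rule metric_CauchyI)
    fix e :: real assume "e > 0"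
    then have "(1 - k) * e > 0" using k by simp
    then obtain N where N: "\<And>m n. m \<ge> N \<Longrightarrow> n \<ge> N \<Longrightarrow>
        dist (x (r m) + K (x (r m))) (x (r n) + K (x (r n))) < (1 - k) * e"
      using cau unfolding Cauchy_def by blast
    have "dist (x (r m)) (x (r n)) < e" if "m \<ge> N" "n \<ge> N" for m n
      using order_le_less_trans[OF contractive_id_plus_expanding[OF K] N[OF that, unfolded dist_norm]] k
      by (simp add: dist_norm)
    then show "\<exists>N. \<forall>m\<ge>N. \<forall>n\<ge>N. dist (x (r m)) (x (r n)) < e" by blast
  qed
  then show ?thesis using r(1) by (meson Cauchy_convergent convergent_def)
qed

lemma (in banach_over) linear_imp_real_linear:
  assumes "Vector_Spaces.linear scl scl A"
  shows "linear A"
proof -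
  interpret A: Vector_Spaces.linear scl scl A by fact
  show ?thesis
    by (rule linearI) (auto simp: A.add simp flip: scl_of_real simp: A.scale)
qed

lemma (in vector_space) linear_inverse:
  fixes A B :: "'b \<Rightarrow> 'b"
  assumes "Vector_Spaces.linear scale scale A" and inv: "\<And>x. B (A x) = x" "\<And>x. A (B x) = x"
  shows "Vector_Spaces.linear scale scale B"
proof -
  interpret A: Vector_Spaces.linear scale scale A by fact
  show ?thesis
    by unfold_locales (metis A.add inv, metis A.scale inv)
qed

theorem corollary2:
  fixes scl :: "'k::real_or_complex \<Rightarrow> 'a::banach \<Rightarrow> 'a"
    and f K C :: "'a \<Rightarrow> 'a" and k :: real
  assumes "banach_over scl"
    and "f = (\<lambda>x. x + K x + C x)"
    and "weakly_coercive f"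
    and "Vector_Spaces.linear scl scl K" and "contractive k K"
    and "C1_operator scl C" and "compact_operator C"
    and "\<And>x. weakly_coercive (\<lambda>v. v + K v + frechet_derivative C (at x) v)"
  shows "C1_diffeomorphism scl f \<and>
    (let K\<^sub>1 = (\<lambda>x. - K x); C\<^sub>1 = (\<lambda>x. - C x) in \<exists>!x. K\<^sub>1 x + C\<^sub>1 x = x)"
proof -
  interpret banach_over scl by fact
  obtain G where G: "\<And>x. (C has_derivative blinfun_apply (G x)) (at x)"
      "\<And>x. Vector_Spaces.linear scl scl (blinfun_apply (G x))" "continuous_on UNIV G"
    using \<open>C1_operator scl C\<close> unfolding C1_operator_def by blast
  have linK: "linear K" using assms(4) by (rule linear_imp_real_linear)
  have "norm (K x) \<le> norm x * k" for x
    using \<open>contractive k K\<close> linear_0[OF linK] unfolding contractive_def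
    by (metis diff_zero mult.commute)
  then have blK: "bounded_linear K"
    by (intro bounded_linear_intro[of K k] linear_add[OF linK] linear_scale[OF linK])
  define D where "D x = id_blinfun + Blinfun K + G x" for x
  have D_apply: "blinfun_apply (D x) v = v + K v + blinfun_apply (G x) v" for x v
    by (simp add: D_def blinfun.bilinear_simps bounded_linear_Blinfun_apply[OF blK])
  have der: "(f has_derivative blinfun_apply (D x)) (at x)" for x
    unfolding assms(2) D_apply[abs_def]
    by (intro has_derivative_add has_derivative_ident bounded_linear.has_derivative[OF blK] G(1))
  have contD: "continuous_on UNIV D"
    unfolding D_def by (intro continuous_intros G(3))
  have linD: "Vector_Spaces.linear scl scl (blinfun_apply (D x))" for x
  proof -
    interpret KL: Vector_Spaces.linear scl scl K by fact
    interpret GL: Vector_Spaces.linear scl scl "blinfun_apply (G x)" by (rule G(2))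
    show ?thesis
      by unfold_locales (auto simp: D_apply KL.add KL.scale GL.add GL.scale scale_right_distrib)
  qed
  \<comment> \<open>Every derivative is a compact perturbation of \<open>I + K\<close> with a lower bound, so it has a bounded inverse.\<close>
  have "\<exists>E. E o\<^sub>L D x = id_blinfun \<and> D x o\<^sub>L E = id_blinfun" for x
  proof -
    have "weakly_coercive (blinfun_apply (D x))"
      using assms(8)[of x] by (simp add: D_apply[abs_def] flip: frechet_derivative_at[OF G(1)])
    then obtain c where c: "c > 0" "\<And>v. c * norm v \<le> norm (blinfun_apply (D x) v)"
      using weakly_coercive_linear_bounded_below blinfun.bounded_linear_right bounded_linear.linear by metis
    have surj: "surj (blinfun_apply (D x))"
      unfolding D_apply[abs_def]
    proof (rule contractive_plus_compact_bounded_below_surj[OF linK \<open>contractive k K\<close> _ _ c(1)])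
      show "bounded_linear (blinfun_apply (G x))" by (rule blinfun.bounded_linear_right)
      show "compact_operator (blinfun_apply (G x))"
        using \<open>compact_operator C\<close> G(1) by (rule compact_operator_derivative)
    qed (use c(2) D_apply in simp)
    have inj: "inj (blinfun_apply (D x))"
    proof (rule injI)
      fix u v assume "blinfun_apply (D x) u = blinfun_apply (D x) v"
      then have "c * norm (u - v) \<le> 0" using c(2)[of "u - v"] by (simp add: blinfun.diff_right)
      then show "u = v" using c(1) by (simp add: mult_le_0_iff)
    qed
    define S where "S = inv (blinfun_apply (D x))"
    have DS: "blinfun_apply (D x) (S v) = v" and SD: "S (blinfun_apply (D x) v) = v" for v
      using surj inj by (auto simp: S_def surj_f_inv_f)
    have "bounded_linear S"
    proof (rule bounded_linear_intro)
      show "S (u + v) = S u + S v" for u v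
        using SD[of "S u + S v"] by (simp add: blinfun.add_right DS)
      show "S (r *\<^sub>R v) = r *\<^sub>R S v" for r v
        using SD[of "r *\<^sub>R S v"] by (simp add: blinfun.scaleR_right DS)
      show "norm (S v) \<le> norm v * (1 / c)" for v
        using c(2)[of "S v"] c(1) by (simp add: DS divide_simps mult.commute)
    qed
    then show ?thesis
      using DS SD by (intro exI[of _ "Blinfun S"]) (auto intro!: blinfun_eqI simp: bounded_linear_Blinfun_apply)
  qed
  then obtain E where E: "\<And>x. E x o\<^sub>L D x = id_blinfun" "\<And>x. D x o\<^sub>L E x = id_blinfun"
    by metis
  then have ED: "blinfun_apply (E x) (blinfun_apply (D x) v) = v" and
    DE: "blinfun_apply (D x) (blinfun_apply (E x) v) = v" for x v
    by (metis blinfun_apply_blinfun_compose blinfun_apply_id_blinfun)+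
  have proper: "\<exists>r a. strict_mono r \<and> (\<lambda>n. x (r n)) \<longlonglongrightarrow> a"
    if "(\<lambda>n. f (x n)) \<longlonglongrightarrow> l" for x l
    using contractive_plus_compact_proper[OF assms(5,7)] assms(2,3) that by simp
  note bij = proper_invertible_derivative_bij[OF der contD E proper]
  have "C1_operator scl f"
    unfolding C1_operator_def using der linD contD by blast
  moreover have "C1_operator scl (inv f)"
    unfolding C1_operator_def
  proof (intro exI[of _ "\<lambda>y. E (inv f y)"] conjI allI)
    fix y
    show "(inv f has_derivative blinfun_apply (E (inv f y))) (at y)"
    proof (rule has_derivative_inverse_basic[OF der, where T = UNIV])
      show "blinfun_apply (E (inv f y)) \<circ> blinfun_apply (D (inv f y)) = id"
        by (auto simp: ED)
      show "continuous (at y) (inv f)"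
        using bij(2) by (simp add: continuous_on_eq_continuous_at)
      show "f (inv f z) = z" for z
        using bij(1) by (simp add: bij_is_surj surj_f_inv_f)
    qed (auto intro: blinfun.bounded_linear_right)
    show "Vector_Spaces.linear scl scl (blinfun_apply (E (inv f y)))"
      using linD ED DE by (rule linear_inverse)
  next
    show "continuous_on UNIV (\<lambda>y. E (inv f y))"
      using continuous_on_compose2[OF continuous_on_blinfun_inverse[OF contD E] bij(2)] by simp
  qed
  ultimately have "C1_diffeomorphism scl f"
    using bij(1) by (simp add: C1_diffeomorphism_def)
  moreover have "\<exists>!x. - K x + - C x = x"
  proof -
    have "f x = x - (- K x + - C x)" for x by (simp add: assms(2))
    then have "- K x + - C x = x \<longleftrightarrow> f x = 0" for x
      by (metis eq_iff_diff_eq_0)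
    then show ?thesis using bij(1) by (simp only: bij_iff)
  qed
  ultimately show ?thesis by (simp add: Let_def)
qed

end
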